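(* Let $\mathfrak{u}$ be a nonprincipal ultrafilter in $\mathbb{N}$, let $(z_n)$ be a sequence in $\mathbb{D}$ with $\lim_{n\to\infty}|z_n|=1$, let $(r_n)$ be a sequence in $(0,1)$, and let $\varphi=\lim_{\mathfrak{u}}\zeta_{D^+(z_n,r_n)}$. Then there exist a sequence $(w_n)$ in $\mathbb{D}$ with $\lim_{n\to\infty}|w_n|=1$ and a sequence $(s_n)$ in $(0,1)$ such that all the disks $D^+(w_n,s_n)$, $n\in\mathbb{N}$, are pairwise disjoint and $\varphi=\lim_{\mathfrak{u}}\zeta_{D^+(w_n,s_n)}$.
   Context: $\mathbb{K}$ is an algebraically closed field, complete with respect to a nontrivial nonarchimedean absolute value $|\cdot|$; $\mathbb{D} = \{z \in \mathbb{K} : |z|<1\}$; $\mathbb{N}=\{1,2,\dots\}$. $H^\infty$ is the Banach $\mathbb{K}$-algebra of bounded power series $f(z)=\sum_{n\ge 0} a_n z^n$ on $\mathbb{D}$, with norm $\|f\| = \sup_n |a_n| = \sup_{z\in\mathbb{D}}|f(z)|$. $D^+(z,r)$ is the closed disk with center $z$ and radius $r$, and for a disk $D\subset\mathbb{D}$, $\zeta_D(f) := \sup_{z\in D}|f(z)|$ for $f\in H^\infty$ (a multiplicative seminorm bounded by $\|\cdot\|$). $\lim_{\mathfrak{u}}$ of a sequence of such seminorms is the pointwise limit on $H^\infty$ along $\mathfrak{u}$. *)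

theory Defs
  imports
    "HOL-Analysis.Elementary_Metric_Spaces"
    "HOL-Computational_Algebra.Computational_Algebra"
    "HOL-Library.Disjoint_Sets"
begin

text \<open>
  Algebraically closed fields, complete with respect to a nontrivial nonarchimedean absolute
  value. Definiteness and nonnegativity of the absolute value are consequences of the metric space
  axioms. The constant \<^const>\<open>norm\<close> is of no use here: it is reserved for real normed
  vector spaces, and the norm of a real normed field is archimedean.
\<close>

class complete_nonarch_field = alg_closed_field + complete_space +
  fixes absval :: "'a \<Rightarrow> real"
  assumes dist_absval: "dist x y = absval (x - y)"
    and absval_mult: "absval (x * y) = absval x * absval y"
    and absval_ultrametric: "absval (x + y) \<le> max (absval x) (absval y)"
    and absval_nontrivial: "\<exists>x. x \<noteq> 0 \<and> absval x \<noteq> 1"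

definition open_unit_disk :: "'a::complete_nonarch_field set" where
  "open_unit_disk = {z. absval z < 1}"

text \<open>
  \<open>H\<^sup>\<infinity>\<close>: the power series with bounded coefficients, whose norm is the
  supremum of the absolute values of the coefficients.
\<close>

definition Hinf :: "'a::complete_nonarch_field fps set" where
  "Hinf = {f. bdd_above (range (\<lambda>n. absval (fps_nth f n)))}"

definition hinf_eval :: "'a::complete_nonarch_field fps \<Rightarrow> 'a \<Rightarrow> 'a" where
  "hinf_eval f z = (\<Sum>n. fps_nth f n * z ^ n)"

definition disk_seminorm :: "'a::complete_nonarch_field set \<Rightarrow> 'a fps \<Rightarrow> real" where
  "disk_seminorm D f = (SUP z\<in>D. absval (hinf_eval f z))"

text \<open>
  An ultrafilter is represented as a filter for which \<^term>\<open>eventually P F\<close> means that the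
  set of all \<open>x\<close> with \<open>P x\<close> is a member. The filter \<^term>\<open>principal {n}\<close> is then the
  principal ultrafilter at \<open>n\<close>.
\<close>

definition ultrafilter :: "'b filter \<Rightarrow> bool" where
  "ultrafilter F \<longleftrightarrow> F \<noteq> bot \<and> (\<forall>P. eventually P F \<or> eventually (\<lambda>x. \<not> P x) F)"

definition nonprincipal_ultrafilter :: "'b filter \<Rightarrow> bool" where
  "nonprincipal_ultrafilter F \<longleftrightarrow> ultrafilter F \<and> (\<forall>n. F \<noteq> principal {n})"

text \<open>
  The series and the suprema above are meaningful: on the open unit disk an element of
  \<^const>\<open>Hinf\<close> converges, and is bounded by any bound of its coefficients; and the closed disks
  with centre in the open unit disk and radius less than \<open>1\<close> lie in the open unit disk.
\<close>

lemma absval_dist_0: "absval x = dist x 0" for x :: "'a::complete_nonarch_field"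
  by (simp add: dist_absval)

lemma absval_nonneg: "0 \<le> absval x" for x :: "'a::complete_nonarch_field"
  by (simp add: absval_dist_0)

lemma absval_minus: "absval (- x) = absval x" for x :: "'a::complete_nonarch_field"
  using dist_absval[of 0 x] dist_absval[of x 0] by (simp add: dist_commute)

lemma absval_one: "absval (1::'a::complete_nonarch_field) = 1"
proof -
  have "absval (1::'a) \<noteq> 0" by (simp add: absval_dist_0)
  then show ?thesis using absval_mult[of 1 "1::'a"] by simp
qed

lemma absval_power: "absval (x ^ n) = absval x ^ n" for x :: "'a::complete_nonarch_field"
  by (induction n) (simp_all add: absval_one absval_mult)

lemma absval_sum_le:
  fixes g :: "'b \<Rightarrow> 'a::complete_nonarch_field"
  assumes "0 \<le> B" "\<And>i. i \<in> A \<Longrightarrow> absval (g i) \<le> B"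
  shows "absval (sum g A) \<le> B"
  using assms(2)
proof (induction A rule: infinite_finite_induct)
  case (insert x A)
  have "absval (g x) \<le> B" "absval (sum g A) \<le> B"
    using insert by auto
  then show ?case
    using absval_ultrametric[of "g x" "sum g A"] insert.hyps by simp
qed (use assms(1) in \<open>auto simp: absval_dist_0\<close>)

lemma cball_subset_open_unit_disk:
  assumes "z \<in> open_unit_disk" "r < 1"
  shows "cball z r \<subseteq> open_unit_disk"
proof
  fix w assume "w \<in> cball z r"
  then have "absval (w - z) < 1"
    using assms(2) by (simp add: dist_commute dist_absval[symmetric])
  then show "w \<in> open_unit_disk"
    using assms(1) absval_ultrametric[of "w - z" z] by (simp add: open_unit_disk_def)
qed

lemma Hinf_summable:
  assumes "f \<in> Hinf" "z \<in> open_unit_disk"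
  shows "summable (\<lambda>n. fps_nth f n * z ^ n)"
proof -
  let ?g = "\<lambda>n. fps_nth f n * z ^ n"
  obtain B where B: "\<And>n. absval (fps_nth f n) \<le> B"
    using assms(1) by (auto simp: Hinf_def bdd_above_def)
  have z: "0 \<le> absval z" "absval z < 1"
    using assms(2) by (auto simp: open_unit_disk_def absval_nonneg)
  have B0: "0 \<le> B" using B[of 0] absval_nonneg[of "fps_nth f 0"] by linarith
  have "Cauchy (\<lambda>n. \<Sum>i<n. ?g i)"
  proof (rule metric_CauchyI)
    fix e :: real assume e: "0 < e"
    have "(\<lambda>n. B * absval z ^ n) \<longlonglongrightarrow> B * 0"
      by (intro tendsto_intros LIMSEQ_realpow_zero z)
    then have "eventually (\<lambda>n. B * absval z ^ n < e) sequentially"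
      using e by (auto dest: order_tendstoD(2))
    then obtain N where N: "B * absval z ^ N < e"
      by (auto simp: eventually_sequentially)
    have *: "dist (\<Sum>i<m. ?g i) (\<Sum>i<n. ?g i) < e" if "N \<le> n" "n \<le> m" for m n
    proof -
      have "(\<Sum>i<m. ?g i) - (\<Sum>i<n. ?g i) = (\<Sum>i\<in>{n..<m}. ?g i)"
        using sum_diff_nat_ivl[of 0 n m ?g] that by (simp add: atLeast0LessThan)
      moreover have "absval (\<Sum>i\<in>{n..<m}. ?g i) \<le> B * absval z ^ N"
      proof (rule absval_sum_le)
        fix i assume "i \<in> {n..<m}"
        then show "absval (?g i) \<le> B * absval z ^ N"
          using B[of i] B0 z that
          by (auto simp: absval_mult absval_power intro!: mult_mono power_decreasing)
      qed (use B0 z in auto)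
      ultimately show ?thesis using N by (simp add: dist_absval)
    qed
    show "\<exists>M. \<forall>m\<ge>M. \<forall>n\<ge>M. dist (\<Sum>i<m. ?g i) (\<Sum>i<n. ?g i) < e"
      using * by (metis dist_commute nle_le)
  qed
  then show ?thesis
    by (simp add: summable_iff_convergent Cauchy_convergent)
qed

lemma Hinf_eval_le:
  assumes "f \<in> Hinf" "z \<in> open_unit_disk" "\<And>n. absval (fps_nth f n) \<le> B"
  shows "absval (hinf_eval f z) \<le> B"
proof -
  let ?S = "\<lambda>n. \<Sum>i<n. fps_nth f i * z ^ i"
  have z: "0 \<le> absval z" "absval z < 1"
    using assms(2) by (auto simp: open_unit_disk_def absval_nonneg)
  have B0: "0 \<le> B" using assms(3)[of 0] absval_nonneg[of "fps_nth f 0"] by linarith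
  have "?S \<longlonglongrightarrow> hinf_eval f z"
    using summable_LIMSEQ[OF Hinf_summable[OF assms(1,2)]] by (simp add: hinf_eval_def)
  then have "(\<lambda>n. dist (?S n) 0) \<longlonglongrightarrow> dist (hinf_eval f z) 0"
    by (intro tendsto_intros)
  moreover have "dist (?S n) 0 \<le> B" for n
  proof -
    have "absval (fps_nth f i * z ^ i) \<le> B" for i
    proof -
      have "absval (fps_nth f i) * absval z ^ i \<le> B * 1"
        using assms(3) B0 z by (intro mult_mono power_le_one) auto
      then show ?thesis by (simp add: absval_mult absval_power)
    qed
    then show ?thesis
      unfolding absval_dist_0[symmetric] by (intro absval_sum_le[OF B0])
  qed
  ultimately show ?thesis
    unfolding absval_dist_0 by (intro LIMSEQ_le_const2) auto
qed

end

theory Submission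
  imports Defs
begin

text \<open>
  Two ideas carry the proof. The first is analytic: replacing \<open>D\<^sup>+(z\<^sub>n, r\<^sub>n)\<close> by any disk
  \<open>D\<^sup>+(w\<^sub>n, s\<^sub>n)\<close> inside it does not change the limit seminorm, provided that
  \<open>s\<^sub>n = r\<^sub>n\<^bsup>1+\<delta>\<^sub>n\<^esup>\<close> with \<open>\<delta>\<^sub>n \<rightarrow> 0\<close>. Indeed Hadamard's three circles
  inequality for the circles of radii \<open>s\<^sub>n\<close>, \<open>r\<^sub>n\<close> and \<open>1\<close> about \<open>w\<^sub>n\<close> bounds the
  \<open>(1+\<delta>\<^sub>n)\<close>-th power of the old seminorm of \<open>f\<close> by the new one times
  \<open>\<parallel>f\<parallel>\<^bsup>\<delta>\<^sub>n\<^esup>\<close> (lemma \<open>disk_seminorm_three_circles\<close>), and the last factor tends to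
  \<open>1\<close>. This covers the Gauss norm too, where the disks are disks about \<open>0\<close> and \<open>r\<^sub>n \<rightarrow> 1\<close>.

  The second is combinatorial: the smaller disks can be chosen pairwise disjoint (lemma
  \<open>ex_disjoint_subdisks\<close>). A given disk contains only finitely many of the other disks, as their
  centres approach the unit circle, and density of the value group leaves room in
  \<open>D\<^sup>+(z\<^sub>n, r\<^sub>n)\<close> for a disk of radius less than \<open>r\<^sub>n\<close> that misses finitely many disks of
  radii less than \<open>r\<^sub>n\<close>.

  The three circles inequality is first proved for polynomials, where it compares Taylor
  coefficients and rests on Cauchy's estimate; it extends to \<open>H\<^sup>\<infinity>\<close> by truncating the
  power series. Working with polynomials avoids recentring an infinite series.
\<close>

section \<open>Ultrametric distances and sums\<close>

lemma dist_ultrametric: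
  fixes x y z :: "'a::complete_nonarch_field"
  shows "dist x z \<le> max (dist x y) (dist y z)"
  using absval_ultrametric[of "x - y" "y - z"] by (simp add: dist_absval)

lemma cball_eq_of_mem:
  fixes w z :: "'a::complete_nonarch_field"
  assumes "w \<in> cball z r"
  shows "cball w r = cball z r"
proof -
  have "dist z w \<le> r" using assms by simp
  then have "dist w x \<le> r \<longleftrightarrow> dist z x \<le> r" for x
    using dist_ultrametric[of w x z] dist_ultrametric[of z x w] by (auto simp: dist_commute)
  then show ?thesis by auto
qed

lemma cball_disjoint_of_dist:
  fixes w c :: "'a::complete_nonarch_field"
  assumes "max s t < dist w c"
  shows "cball w s \<inter> cball c t = {}"
proof (rule equals0I)
  fix x assume "x \<in> cball w s \<inter> cball c t"
  then show False
    using assms dist_ultrametric[of w c x] by (auto simp: dist_commute)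
qed

lemma absval_eq_of_dist_less:
  fixes x y :: "'a::complete_nonarch_field"
  assumes "dist x y < absval y"
  shows "absval x = absval y"
  using assms dist_ultrametric[of y 0 x] dist_ultrametric[of x 0 y]
  by (auto simp: absval_dist_0 dist_commute)

lemma absval_diff_ge:
  fixes x y :: "'a::complete_nonarch_field"
  assumes "absval x \<noteq> absval y"
  shows "absval x \<le> absval (x - y)"
proof (rule ccontr)
  assume "\<not> ?thesis"
  then have "dist y x < absval x"
    by (simp add: dist_commute[of y x] dist_absval[of x y])
  then show False using absval_eq_of_dist_less[of y x] assms by simp
qed

lemma absval_sum_less:
  fixes g :: "'b \<Rightarrow> 'a::complete_nonarch_field"
  assumes "0 < B" "\<And>i. i \<in> A \<Longrightarrow> absval (g i) < B"
  shows "absval (sum g A) < B"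
  using assms(2)
proof (induction A rule: infinite_finite_induct)
  case (insert x A)
  have "absval (g x) < B" "absval (sum g A) < B"
    using insert by auto
  then show ?case
    using absval_ultrametric[of "g x" "sum g A"] insert.hyps by simp
qed (use assms(1) in \<open>auto simp: absval_dist_0\<close>)

text \<open>
  If no two nonzero terms have the same absolute value, the largest term dominates strictly, so
  nothing cancels it.
\<close>

lemma absval_sum_ge_of_distinct:
  fixes g :: "'b \<Rightarrow> 'a::complete_nonarch_field"
  assumes "finite A" "k \<in> A"
    and distinct: "\<And>i j. i \<in> A \<Longrightarrow> j \<in> A \<Longrightarrow> i \<noteq> j \<Longrightarrow> g i \<noteq> 0 \<Longrightarrow> g j \<noteq> 0 \<Longrightarrow>
      absval (g i) \<noteq> absval (g j)"
  shows "absval (g k) \<le> absval (sum g A)"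
proof (cases "g k = 0")
  case True
  then show ?thesis by (simp add: absval_dist_0)
next
  case False
  have "Max ((\<lambda>i. absval (g i)) ` A) \<in> (\<lambda>i. absval (g i)) ` A"
    using assms(1,2) by (intro Max_in) auto
  then obtain j where j: "j \<in> A" "Max ((\<lambda>i. absval (g i)) ` A) = absval (g j)"
    by auto
  then have max: "absval (g i) \<le> absval (g j)" if "i \<in> A" for i
    using Max_ge[of "(\<lambda>i. absval (g i)) ` A" "absval (g i)"] assms(1) that by simp
  have gk: "0 < absval (g k)"
    using False by (simp add: absval_dist_0)
  then have gj: "0 < absval (g j)"
    using max[OF assms(2)] by linarith
  have rest: "absval (sum g (A - {j})) < absval (g j)"
  proof (rule absval_sum_less[OF gj])
    fix i assume i: "i \<in> A - {j}"
    show "absval (g i) < absval (g j)"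
    proof (cases "g i = 0")
      case True
      then show ?thesis using gj by (simp add: absval_dist_0)
    next
      case False
      have "g j \<noteq> 0" using gj by (auto simp: absval_dist_0)
      then show ?thesis
        using distinct[of i j] max[of i] False i j by fastforce
    qed
  qed
  have "sum g A = g j + sum g (A - {j})"
    using assms(1) j(1) by (rule sum.remove)
  then have "absval (sum g A) = absval (g j)"
    using rest by (intro absval_eq_of_dist_less) (simp add: dist_absval)
  then show ?thesis using max[OF assms(2)] by simp
qed

section \<open>Density of the value group\<close>

lemma ex_absval_gt_1: "\<exists>a::'a::complete_nonarch_field. 1 < absval a"
proof -
  obtain x :: 'a where x: "x \<noteq> 0" "absval x \<noteq> 1"
    using absval_nontrivial by blast
  have inv: "absval x * absval (inverse x) = 1"
    using x(1) by (simp add: absval_mult[symmetric] absval_one)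
  show ?thesis
  proof (cases "1 < absval x")
    case False
    then have "absval x < 1" using x by simp
    moreover have "0 < absval x" using x(1) by (simp add: absval_dist_0)
    moreover have "absval (inverse x) = 1 / absval x"
      using inv calculation by (simp add: field_simps)
    ultimately have "1 < absval (inverse x)" by simp
    then show ?thesis by blast
  qed blast
qed

text \<open>
  An element of absolute value greater than \<open>1\<close> has roots of every order, so there is a
  \<open>y\<close> with \<open>1 < \<bar>y\<bar> < r/t\<close>. Multiplying by \<open>y\<close> repeatedly, starting below \<open>t\<close>, cannot
  jump over the interval from \<open>t\<close> to \<open>r\<close>.
\<close>

lemma absval_dense:
  assumes "t < r" "0 < r"
  shows "\<exists>x::'a::complete_nonarch_field. t < absval x \<and> absval x < r"
proof -
  define t' where "t' = max t (r/2)"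
  have t': "0 < t'" "t' < r" "t \<le> t'"
    using assms by (auto simp: t'_def)
  obtain a :: 'a where a: "1 < absval a"
    using ex_absval_gt_1 by blast
  obtain N where N: "absval a < (r/t') ^ N"
    using real_arch_pow[of "r/t'" "absval a"] t' by auto
  have "N > 0"
    using N a by (cases N) auto
  then obtain y :: 'a where y: "y ^ N = a"
    using nth_root_exists by metis
  have yN: "absval y ^ N = absval a"
    using y by (metis absval_power)
  have y_less: "absval y < r/t'"
    using N yN t' by (intro power_less_imp_less_base[of "absval y" N]) auto
  have y_gt: "1 < absval y"
    using a yN by (metis absval_nonneg linorder_not_le power_le_one)
  obtain M where M: "1/t' < absval a ^ M"
    using real_arch_pow[OF a] by blast
  define c where "c = inverse (a ^ M)"
  have a0: "a \<noteq> 0" using a by (auto simp: absval_dist_0)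
  have "c * a ^ M = 1"
    using a0 by (simp add: c_def)
  then have ca: "absval c * absval a ^ M = 1"
    by (metis absval_mult absval_one absval_power)
  have c0: "0 < absval c"
    using a0 by (simp add: c_def absval_dist_0)
  have c: "absval c < t'"
  proof -
    have "absval c * (1/t') < absval c * absval a ^ M"
      using M c0 by (intro mult_strict_left_mono)
    then show ?thesis using ca t' by (simp add: field_simps)
  qed
  define m where "m = (LEAST m. t' < absval c * absval y ^ m)"
  have "\<exists>m. t' < absval c * absval y ^ m"
    using real_arch_pow[OF y_gt, of "t'/absval c"] c0 by (auto simp: field_simps)
  then have m: "t' < absval c * absval y ^ m"
    unfolding m_def by (rule LeastI_ex)
  then have "m \<noteq> 0"
    using c by (intro notI) simp
  then obtain k where k: "m = Suc k"
    by (cases m) auto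
  have "absval c * absval y ^ k \<le> t'"
    using not_less_Least[of k "\<lambda>m. t' < absval c * absval y ^ m"] k by (simp add: m_def)
  then have "absval c * absval y ^ k * absval y \<le> t' * absval y"
    using y_gt by (intro mult_right_mono) auto
  also have "\<dots> < r"
    using y_less t' by (simp add: field_simps)
  finally have "absval (c * y ^ m) < r"
    by (simp add: k absval_mult absval_power ac_simps)
  moreover have "t < absval (c * y ^ m)"
    using m t' by (simp add: absval_mult absval_power)
  ultimately show ?thesis by blast
qed

text \<open>
  The finitely many excluded values below \<open>r\<close> have a maximum; density applies above it.
\<close>

lemma absval_dense_avoiding:
  assumes "t < r" "0 < r" "finite E"
  shows "\<exists>x::'a::complete_nonarch_field. t < absval x \<and> absval x < r \<and> absval x \<notin> E"
proof -
  define t' where "t' = Max (insert t {e \<in> E. e < r})"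
  have t': "t' < r" "t \<le> t'" "\<And>e. e \<in> E \<Longrightarrow> e < r \<Longrightarrow> e \<le> t'"
    using assms by (auto simp: t'_def)
  obtain x :: 'a where "t' < absval x" "absval x < r"
    using absval_dense[OF t'(1) assms(2)] by blast
  then show ?thesis
    using t' by (intro exI[of _ x]) force
qed

text \<open>
  If \<open>\<bar>x\<bar>\<close> differs from \<open>\<bar>c - z\<bar>\<close>, nothing cancels in \<open>x - (c - z)\<close>, so
  \<open>z + x\<close> is at least \<open>\<bar>x\<bar>\<close> away from \<open>c\<close>.
\<close>

lemma ex_far_point_in_cball:
  fixes z :: "'a::complete_nonarch_field"
  assumes "t < r" "0 < r" "finite F"
  shows "\<exists>w\<in>cball z r. \<forall>c\<in>F. t < dist w c"
proof -
  obtain x :: 'a where x: "t < absval x" "absval x < r" "absval x \<notin> (\<lambda>c. absval (c - z)) ` F"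
    using absval_dense_avoiding[of t r "(\<lambda>c. absval (c - z)) ` F"] assms by auto
  have "t < dist (z + x) c" if "c \<in> F" for c
    using absval_diff_ge[of x "c - z"] x that by (force simp: dist_absval algebra_simps)
  moreover have "z + x \<in> cball z r"
    using x by (simp add: dist_absval absval_minus)
  ultimately show ?thesis by blast
qed

section \<open>Three circles\<close>

text \<open>
  Two nonzero monomials have the same absolute value on at most one circle. So on all but finitely
  many circles the absolute values of the nonzero terms of a polynomial are pairwise distinct, and
  no term exceeds the value of the polynomial. Since the value group is dense, there are such
  circles of radius as close to \<open>s\<close> as needed.
\<close>

lemma poly_cauchy_estimate:
  fixes q :: "'a::complete_nonarch_field poly"
  assumes "0 < s" and bound: "\<And>u. absval u \<le> s \<Longrightarrow> absval (poly q u) \<le> B"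
  shows "absval (coeff q k) * s ^ k \<le> B"
proof (rule ccontr)
  let ?b = "\<lambda>i. absval (coeff q i)"
  assume "\<not> ?thesis"
  then have gt: "B < ?b k * s ^ k" by simp
  have "0 \<le> B"
    using bound[of 0] assms(1) absval_nonneg[of "poly q 0"] absval_dist_0[of "0::'a"] by simp
  then have bk: "coeff q k \<noteq> 0"
    using gt by (auto simp: absval_dist_0)
  have "((\<lambda>t. ?b k * t ^ k) \<longlongrightarrow> ?b k * s ^ k) (at_left s)"
    by (intro tendsto_intros)
  then have "eventually (\<lambda>t. B < ?b k * t ^ k) (at_left s)"
    using gt by (rule order_tendstoD(1))
  then obtain t where t: "t < s" "\<And>y. t < y \<Longrightarrow> y < s \<Longrightarrow> B < ?b k * y ^ k"
    by (auto simp: eventually_at_left_field)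
  define P where "P i j = monom (?b i) i - monom (?b j) j" for i j
  \<comment> \<open>the radii on which two different monomials of \<open>q\<close>, not both zero, have equal absolute values\<close>
  define E where "E = (\<Union>i\<le>degree q. \<Union>j\<in>{j. j \<le> degree q \<and> P i j \<noteq> 0}. {y. poly (P i j) y = 0})"
  have "finite E"
    unfolding E_def by (auto intro!: poly_roots_finite)
  then obtain u :: 'a where u: "max 0 t < absval u" "absval u < s" "absval u \<notin> E"
    using absval_dense_avoiding[of "max 0 t" s E] t(1) assms(1) by auto
  have "absval (coeff q k * u ^ k) \<le> absval (\<Sum>i\<le>degree q. coeff q i * u ^ i)"
  proof (rule absval_sum_ge_of_distinct)
    show "k \<in> {..degree q}" using bk le_degree by auto
    fix i j assume ij: "i \<in> {..degree q}" "j \<in> {..degree q}" "i \<noteq> j"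
      and nz: "coeff q i * u ^ i \<noteq> 0" "coeff q j * u ^ j \<noteq> 0"
    have "coeff (P i j) i \<noteq> 0"
      using ij nz by (simp add: P_def absval_dist_0)
    then have "P i j \<noteq> 0" by auto
    then have "poly (P i j) (absval u) \<noteq> 0"
      using u(3) ij by (auto simp: E_def)
    then show "absval (coeff q i * u ^ i) \<noteq> absval (coeff q j * u ^ j)"
      by (simp add: P_def poly_monom absval_mult absval_power)
  qed simp
  then have "?b k * absval u ^ k \<le> absval (poly q u)"
    by (simp add: absval_mult absval_power poly_altdef)
  then show False
    using t(2)[of "absval u"] u bound[of u] by auto
qed

text \<open>
  The Taylor coefficients at \<open>w\<close> are combinations of the coefficients with factors of absolute
  value at most \<open>1\<close>. Horner's recursion makes this an induction.
\<close>

lemma absval_coeff_pcompose_shift_le: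
  fixes p :: "'a::complete_nonarch_field poly"
  assumes "absval w \<le> 1" "0 \<le> C" "\<And>i. absval (coeff p i) \<le> C"
  shows "absval (coeff (pcompose p [:w, 1:]) i) \<le> C"
  using assms(3)
proof (induction p arbitrary: i)
  case 0
  then show ?case using assms(2) by (simp add: absval_dist_0)
next
  case (pCons a p)
  let ?r = "pcompose p [:w, 1:]"
  have r: "absval (coeff ?r j) \<le> C" for j
  proof (rule pCons.IH)
    show "absval (coeff p i) \<le> C" for i
      using pCons.prems[of "Suc i"] by simp
  qed
  have 1: "absval (coeff [:a:] i) \<le> C"
    using pCons.prems[of 0] assms(2) by (cases i) (auto simp: absval_dist_0)
  have 2: "absval (w * coeff ?r i) \<le> C"
    using mult_mono[OF assms(1) r[of i]] by (simp add: absval_mult absval_nonneg)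
  have 3: "absval (coeff (pCons 0 ?r) i) \<le> C"
    using r assms(2) by (cases i) (auto simp: absval_dist_0)
  have "coeff (pcompose (pCons a p) [:w, 1:]) i
      = coeff [:a:] i + (w * coeff ?r i + coeff (pCons 0 ?r) i)"
    by (simp add: pcompose_pCons)
  then show ?case
    using 1 2 3 absval_ultrametric[of "coeff [:a:] i" "w * coeff ?r i + coeff (pCons 0 ?r) i"]
      absval_ultrametric[of "w * coeff ?r i" "coeff (pCons 0 ?r) i"] by simp
qed

text \<open>
  Hadamard's three circles inequality for the radii \<open>r\<^bsup>1+\<delta>\<^esup>\<close>, \<open>r\<close> and \<open>1\<close> about \<open>w\<close>,
  where \<open>C\<close> is the bound for radius \<open>1\<close>. Let \<open>b\<^sub>i\<close> be the Taylor coefficients at \<open>w\<close>. Then \<open>(\<bar>b\<^sub>i\<bar> r\<^sup>i)\<^bsup>1+\<delta>\<^esup>\<close> is the product of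
  \<open>\<bar>b\<^sub>i\<bar> (r\<^bsup>1+\<delta>\<^esup>)\<^sup>i\<close>, bounded by the Cauchy estimate, and \<open>\<bar>b\<^sub>i\<bar>\<^bsup>\<delta>\<^esup> \<le> C\<^bsup>\<delta>\<^esup>\<close>.
\<close>

lemma poly_three_circles:
  fixes p :: "'a::complete_nonarch_field poly"
  assumes coeffs: "\<And>i. absval (coeff p i) \<le> C" and w: "absval w \<le> 1"
    and r: "0 < r" and \<delta>: "0 \<le> \<delta>"
    and bound: "\<And>v. dist w v \<le> r powr (1 + \<delta>) \<Longrightarrow> absval (poly p v) \<le> B"
    and u: "dist w u \<le> r"
  shows "absval (poly p u) powr (1 + \<delta>) \<le> B * C powr \<delta>"
proof -
  define q where "q = pcompose p [:w, 1:]"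
  define M where "M = (B * C powr \<delta>) powr (1 / (1 + \<delta>))"
  have C: "0 \<le> C" using coeffs[of 0] absval_nonneg[of "coeff p 0"] by linarith
  have B: "0 \<le> B" using bound[of w] absval_nonneg[of "poly p w"] by simp
  have q: "poly q v = poly p (w + v)" for v
    by (simp add: q_def poly_pcompose ac_simps)
  have q_coeff: "absval (coeff q i) \<le> C" for i
    unfolding q_def by (rule absval_coeff_pcompose_shift_le[OF w C coeffs])
  have cauchy: "absval (coeff q i) * (r powr (1 + \<delta>)) ^ i \<le> B" for i
    using r by (intro poly_cauchy_estimate) (auto simp: q dist_absval absval_minus intro!: bound)
  have term_le: "absval (coeff q i * (u - w) ^ i) \<le> M" for i
  proof -
    let ?b = "absval (coeff q i)"
    have b: "0 \<le> ?b" by (rule absval_nonneg)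
    have "(?b * r ^ i) powr (1 + \<delta>) = (?b powr 1 * ?b powr \<delta>) * (r ^ i) powr (1 + \<delta>)"
      using b r by (simp add: powr_mult powr_add)
    also have "(r ^ i) powr (1 + \<delta>) = (r powr (1 + \<delta>)) ^ i"
      using r by (simp add: powr_realpow[symmetric] powr_powr ac_simps)
    also have "(?b powr 1 * ?b powr \<delta>) * (r powr (1 + \<delta>)) ^ i
        = (?b * (r powr (1 + \<delta>)) ^ i) * ?b powr \<delta>"
      using b by simp
    also have "\<dots> \<le> B * C powr \<delta>"
      using cauchy[of i] q_coeff[of i] b B \<delta> by (intro mult_mono powr_mono2) auto
    finally have "((?b * r ^ i) powr (1 + \<delta>)) powr (1 / (1 + \<delta>)) \<le> M"
      unfolding M_def using \<delta> by (intro powr_mono2) auto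
    then have "?b * r ^ i \<le> M"
      using b r \<delta> by (simp add: powr_powr)
    moreover have "?b * absval (u - w) ^ i \<le> ?b * r ^ i"
      using u by (intro mult_left_mono power_mono)
        (auto simp: absval_nonneg dist_commute dist_absval[symmetric])
    ultimately show ?thesis by (simp add: absval_mult absval_power)
  qed
  have "poly p u = (\<Sum>i\<le>degree q. coeff q i * (u - w) ^ i)"
    using q[of "u - w"] by (simp add: poly_altdef)
  moreover have "absval (\<Sum>i\<le>degree q. coeff q i * (u - w) ^ i) \<le> M"
    by (intro absval_sum_le term_le) (simp add: M_def)
  ultimately have "absval (poly p u) powr (1 + \<delta>) \<le> M powr (1 + \<delta>)"
    using \<delta> by (intro powr_mono2) (auto simp: absval_nonneg)
  also have "\<dots> = B * C powr \<delta>"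
    using \<delta> B by (simp add: M_def powr_powr)
  finally show ?thesis .
qed

lemma hinf_eval_truncation_error:
  assumes f: "f \<in> Hinf" "\<And>n. absval (fps_nth f n) \<le> C" and z: "z \<in> open_unit_disk"
  shows "dist (hinf_eval f z) (\<Sum>i<N. fps_nth f i * z ^ i) \<le> C * absval z ^ N"
proof -
  let ?S = "\<lambda>n. \<Sum>i<n. fps_nth f i * z ^ i"
  have C: "0 \<le> C" using f(2)[of 0] absval_nonneg[of "fps_nth f 0"] by linarith
  have z': "0 \<le> absval z" "absval z \<le> 1"
    using z by (auto simp: open_unit_disk_def absval_nonneg)
  have "?S \<longlonglongrightarrow> hinf_eval f z"
    using summable_LIMSEQ[OF Hinf_summable[OF f(1) z]] by (simp add: hinf_eval_def)
  then have "(\<lambda>n. dist (?S n) (?S N)) \<longlonglongrightarrow> dist (hinf_eval f z) (?S N)"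
    by (intro tendsto_intros)
  moreover have "dist (?S n) (?S N) \<le> C * absval z ^ N" if "N \<le> n" for n
  proof -
    have "?S n - ?S N = (\<Sum>i\<in>{N..<n}. fps_nth f i * z ^ i)"
      using sum_diff_nat_ivl[of 0 N n "\<lambda>i. fps_nth f i * z ^ i"] that
      by (simp add: atLeast0LessThan)
    moreover have "absval (\<Sum>i\<in>{N..<n}. fps_nth f i * z ^ i) \<le> C * absval z ^ N"
    proof (rule absval_sum_le)
      fix i assume "i \<in> {N..<n}"
      then show "absval (fps_nth f i * z ^ i) \<le> C * absval z ^ N"
        using f(2)[of i] C z' by (auto simp: absval_mult absval_power intro!: mult_mono power_decreasing)
    qed (use C z' in auto)
    ultimately show ?thesis by (simp add: dist_absval)
  qed
  ultimately show ?thesis by (intro LIMSEQ_le_const2) auto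
qed

section \<open>Seminorms of disks\<close>

lemma Hinf_coeff_bound:
  assumes "f \<in> Hinf"
  obtains C where "1 \<le> C" "\<And>n. absval (fps_nth f n) \<le> C"
proof -
  obtain B where "\<And>n. absval (fps_nth f n) \<le> B"
    using assms by (auto simp: Hinf_def bdd_above_def)
  then show ?thesis by (intro that[of "max 1 B"]) (auto simp: le_max_iff_disj)
qed

lemma absval_hinf_eval_le_disk_seminorm:
  assumes "f \<in> Hinf" "D \<subseteq> open_unit_disk" "v \<in> D"
  shows "absval (hinf_eval f v) \<le> disk_seminorm D f"
proof -
  obtain C where "\<And>n. absval (fps_nth f n) \<le> C"
    using Hinf_coeff_bound[OF assms(1)] by blast
  then have "bdd_above ((\<lambda>v. absval (hinf_eval f v)) ` D)"
    using Hinf_eval_le assms by (intro bdd_aboveI2[of _ _ C]) blast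
  then show ?thesis
    unfolding disk_seminorm_def using assms(3) by (intro cSUP_upper)
qed

lemma disk_seminorm_nonneg:
  assumes "f \<in> Hinf" "D \<subseteq> open_unit_disk" "D \<noteq> {}"
  shows "0 \<le> disk_seminorm D f"
  using assms absval_hinf_eval_le_disk_seminorm absval_nonneg
  by (metis all_not_in_conv order_trans)

lemma disk_seminorm_mono:
  assumes "f \<in> Hinf" "D' \<subseteq> open_unit_disk" "D \<subseteq> D'" "D \<noteq> {}"
  shows "disk_seminorm D f \<le> disk_seminorm D' f"
  unfolding disk_seminorm_def[of D]
  using assms absval_hinf_eval_le_disk_seminorm[OF assms(1,2)] by (intro cSUP_least) auto

text \<open>
  The polynomial inequality passes to the limit along the partial sums, which converge uniformly
  on every closed disk of radius less than \<open>1\<close>.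
\<close>

lemma Hinf_three_circles:
  fixes f :: "'a::complete_nonarch_field fps"
  assumes f: "f \<in> Hinf" "\<And>n. absval (fps_nth f n) \<le> C" and w: "w \<in> open_unit_disk"
    and r: "0 < r" "r < 1" and \<delta>: "0 \<le> \<delta>" and u: "dist w u \<le> r"
  shows "absval (hinf_eval f u) powr (1 + \<delta>)
    \<le> disk_seminorm (cball w (r powr (1 + \<delta>))) f * C powr \<delta>"
proof -
  let ?s = "r powr (1 + \<delta>)"
  let ?S = "\<lambda>N v. \<Sum>i<N. fps_nth f i * v ^ i"
  define R where "R = max (absval w) r"
  have C: "0 \<le> C" using f(2)[of 0] absval_nonneg[of "fps_nth f 0"] by linarith
  have R: "0 \<le> R" "R < 1"
    using w r by (auto simp: R_def open_unit_disk_def)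
  have s: "?s \<le> r"
    using r \<delta> powr_mono'[of 1 "1 + \<delta>" r] by simp
  have absval_le: "absval v \<le> R" if "dist w v \<le> r" for v
    using dist_ultrametric[of v 0 w] that by (auto simp: R_def absval_dist_0 dist_commute)
  have err: "dist (hinf_eval f v) (?S N v) \<le> C * R ^ N" if "dist w v \<le> r" for v N
  proof -
    have "v \<in> open_unit_disk"
      using absval_le[OF that] R by (simp add: open_unit_disk_def)
    then have "dist (hinf_eval f v) (?S N v) \<le> C * absval v ^ N"
      by (rule hinf_eval_truncation_error[OF f])
    also have "\<dots> \<le> C * R ^ N"
      using absval_le[OF that] C by (intro mult_left_mono power_mono) (auto simp: absval_nonneg)
    finally show ?thesis .
  qed
  have D: "cball w ?s \<subseteq> open_unit_disk"
    using s r by (intro cball_subset_open_unit_disk[OF w]) auto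
  have ineq: "absval (?S N u) powr (1 + \<delta>) \<le> (disk_seminorm (cball w ?s) f + C * R ^ N) * C powr \<delta>"
    for N
  proof -
    define p where "p = (\<Sum>i<N. monom (fps_nth f i) i)"
    have p: "poly p v = ?S N v" for v
      by (simp add: p_def poly_sum poly_monom)
    have "absval (poly p u) powr (1 + \<delta>) \<le> (disk_seminorm (cball w ?s) f + C * R ^ N) * C powr \<delta>"
    proof (rule poly_three_circles[OF _ _ r(1) \<delta> _ u])
      show "absval (coeff p i) \<le> C" for i
        using f(2)[of i] C by (auto simp: p_def coeff_sum absval_dist_0 if_distrib cong: if_cong)
      show "absval w \<le> 1" using w by (simp add: open_unit_disk_def)
      fix v assume v: "dist w v \<le> ?s"
      have "absval (poly p v) \<le> absval (hinf_eval f v) + dist (hinf_eval f v) (?S N v)"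
        using dist_triangle[of "?S N v" 0 "hinf_eval f v"]
        by (simp add: p absval_dist_0 dist_commute)
      also have "\<dots> \<le> disk_seminorm (cball w ?s) f + C * R ^ N"
        using v s by (intro add_mono absval_hinf_eval_le_disk_seminorm[OF f(1) D] err) auto
      finally show "absval (poly p v) \<le> disk_seminorm (cball w ?s) f + C * R ^ N" .
    qed
    then show ?thesis by (simp add: p)
  qed
  have RN: "(\<lambda>N. C * R ^ N) \<longlonglongrightarrow> C * 0"
    using R by (intro tendsto_intros LIMSEQ_realpow_zero)
  have "(\<lambda>N. dist (?S N u) (hinf_eval f u)) \<longlonglongrightarrow> 0"
  proof (rule tendsto_sandwich[of "\<lambda>_. 0"])
    show "\<forall>\<^sub>F N in sequentially. dist (?S N u) (hinf_eval f u) \<le> C * R ^ N"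
      using err[OF u] by (simp add: dist_commute)
  qed (use RN in auto)
  then have "(\<lambda>N. ?S N u) \<longlonglongrightarrow> hinf_eval f u"
    by (subst tendsto_dist_iff)
  then have "(\<lambda>N. absval (?S N u)) \<longlonglongrightarrow> absval (hinf_eval f u)"
    unfolding absval_dist_0 by (intro tendsto_intros)
  then have lim_left: "(\<lambda>N. absval (?S N u) powr (1 + \<delta>)) \<longlonglongrightarrow> absval (hinf_eval f u) powr (1 + \<delta>)"
    using \<delta> by (intro tendsto_powr') (auto simp: absval_nonneg)
  have "(\<lambda>N. (disk_seminorm (cball w ?s) f + C * R ^ N) * C powr \<delta>)
      \<longlonglongrightarrow> (disk_seminorm (cball w ?s) f + C * 0) * C powr \<delta>"
    by (rule tendsto_mult[OF tendsto_add[OF tendsto_const RN] tendsto_const])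
  with lim_left ineq show ?thesis
    by (intro LIMSEQ_le[where X = "\<lambda>N. absval (?S N u) powr (1 + \<delta>)"]) auto
qed

text \<open>
  Every point of a disk is a centre of it, so the smaller disk may have its centre at any point
  \<open>w\<close> of the larger one.
\<close>

lemma disk_seminorm_three_circles:
  fixes f :: "'a::complete_nonarch_field fps"
  assumes f: "f \<in> Hinf" "\<And>n. absval (fps_nth f n) \<le> C" and z: "z \<in> open_unit_disk"
    and r: "0 < r" "r < 1" and \<delta>: "0 \<le> \<delta>" and w: "w \<in> cball z r"
  shows "disk_seminorm (cball z r) f powr (1 + \<delta>)
    \<le> disk_seminorm (cball w (r powr (1 + \<delta>))) f * C powr \<delta>"
proof -
  let ?B = "disk_seminorm (cball w (r powr (1 + \<delta>))) f"
  have D: "cball z r \<subseteq> open_unit_disk"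
    using z r by (intro cball_subset_open_unit_disk)
  have w': "w \<in> open_unit_disk" using w D by auto
  have "r powr (1 + \<delta>) \<le> r powr 1"
    using r \<delta> by (intro powr_mono') auto
  then have "r powr (1 + \<delta>) < 1"
    using r by simp
  then have "cball w (r powr (1 + \<delta>)) \<subseteq> open_unit_disk"
    by (rule cball_subset_open_unit_disk[OF w'])
  then have B: "0 \<le> ?B"
    by (rule disk_seminorm_nonneg[OF f(1)]) simp
  have A: "0 \<le> disk_seminorm (cball z r) f"
    using r by (intro disk_seminorm_nonneg[OF f(1) D]) simp
  have "disk_seminorm (cball z r) f \<le> (?B * C powr \<delta>) powr (1 / (1 + \<delta>))"
    unfolding disk_seminorm_def[of "cball z r"]
  proof (rule cSUP_least)
    show "cball z r \<noteq> {}" using r by simp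
    fix u assume "u \<in> cball z r"
    then have "dist w u \<le> r" by (simp only: cball_eq_of_mem[OF w, symmetric] mem_cball)
    then have "absval (hinf_eval f u) powr (1 + \<delta>) \<le> ?B * C powr \<delta>"
      by (rule Hinf_three_circles[OF f w' r \<delta>])
    then have "(absval (hinf_eval f u) powr (1 + \<delta>)) powr (1 / (1 + \<delta>))
        \<le> (?B * C powr \<delta>) powr (1 / (1 + \<delta>))"
      using \<delta> by (intro powr_mono2) simp_all
    then show "absval (hinf_eval f u) \<le> (?B * C powr \<delta>) powr (1 / (1 + \<delta>))"
      using \<delta> by (simp add: powr_powr absval_nonneg)
  qed
  then have "disk_seminorm (cball z r) f powr (1 + \<delta>)
      \<le> ((?B * C powr \<delta>) powr (1 / (1 + \<delta>))) powr (1 + \<delta>)"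
    using \<delta> A by (intro powr_mono2) simp_all
  also have "\<dots> = ?B * C powr \<delta>"
    using \<delta> B by (simp add: powr_powr)
  finally show ?thesis .
qed

text \<open>
  With an exponent tending to \<open>1\<close>, the three circles inequality and monotonicity squeeze the
  seminorm of the smaller disk, for each \<open>f\<close>, between two quantities with the same limit.
\<close>

lemma tendsto_disk_seminorm_shrunk:
  fixes f :: "'a::complete_nonarch_field fps" and z w :: "nat \<Rightarrow> 'a"
  assumes f: "f \<in> Hinf" and z: "\<And>n. z n \<in> open_unit_disk" and r: "\<And>n. r n \<in> {0<..<1}"
    and w: "\<And>n. w n \<in> cball (z n) (r n)"
    and \<delta>: "\<And>n. 0 \<le> \<delta> n" "(\<delta> \<longlongrightarrow> 0) F"
    and lim: "((\<lambda>n. disk_seminorm (cball (z n) (r n)) f) \<longlongrightarrow> L) F"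
  shows "((\<lambda>n. disk_seminorm (cball (w n) (r n powr (1 + \<delta> n))) f) \<longlongrightarrow> L) F"
proof -
  let ?A = "\<lambda>n. disk_seminorm (cball (z n) (r n)) f"
  let ?B = "\<lambda>n. disk_seminorm (cball (w n) (r n powr (1 + \<delta> n))) f"
  obtain C where C: "1 \<le> C" "\<And>n. absval (fps_nth f n) \<le> C"
    using Hinf_coeff_bound[OF f] by blast
  have D: "cball (z n) (r n) \<subseteq> open_unit_disk" for n
    using z r[of n] by (intro cball_subset_open_unit_disk) auto
  have A: "0 \<le> ?A n" for n
    using D r[of n] by (intro disk_seminorm_nonneg f) auto
  have upper: "?B n \<le> ?A n" for n
  proof (rule disk_seminorm_mono[OF f D])
    have "r n powr (1 + \<delta> n) \<le> r n"
      using r[of n] \<delta>(1)[of n] powr_mono'[of 1 "1 + \<delta> n" "r n"] by simp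
    then show "cball (w n) (r n powr (1 + \<delta> n)) \<subseteq> cball (z n) (r n)"
      using cball_eq_of_mem[OF w[of n]] subset_cball[of "r n powr (1 + \<delta> n)" "r n" "w n"] by simp
    show "cball (w n) (r n powr (1 + \<delta> n)) \<noteq> {}" by simp
  qed
  have lower: "?A n powr (1 + \<delta> n) / C powr \<delta> n \<le> ?B n" for n
    using disk_seminorm_three_circles[OF f C(2) z _ _ \<delta>(1)[of n] w[of n]] r[of n] C(1)
    by (simp add: pos_divide_le_eq)
  have "((\<lambda>n. ?A n powr (1 + \<delta> n)) \<longlongrightarrow> L powr (1 + 0)) F"
    by (rule tendsto_powr'[OF lim tendsto_add[OF tendsto_const \<delta>(2)]]) (simp add: A)
  moreover have "((\<lambda>n. C powr \<delta> n) \<longlongrightarrow> C powr 0) F"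
    using C(1) by (intro tendsto_powr[OF tendsto_const \<delta>(2)]) simp
  ultimately have "((\<lambda>n. ?A n powr (1 + \<delta> n) / C powr \<delta> n) \<longlongrightarrow> L powr (1 + 0) / C powr 0) F"
    by (rule tendsto_divide) (use C(1) in simp)
  moreover have "L powr (1 + 0) / C powr 0 = L" if "F \<noteq> bot"
  proof -
    have "0 \<le> L"
      by (rule tendsto_lowerbound[OF lim _ that]) (simp add: A)
    then show ?thesis using C(1) by simp
  qed
  ultimately have lower_lim: "((\<lambda>n. ?A n powr (1 + \<delta> n) / C powr \<delta> n) \<longlongrightarrow> L) F"
    by (cases "F = bot") simp_all
  show ?thesis
  proof (rule tendsto_sandwich[OF _ _ lower_lim lim])
    show "\<forall>\<^sub>F n in F. ?A n powr (1 + \<delta> n) / C powr \<delta> n \<le> ?B n"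
      by (intro always_eventually allI lower)
    show "\<forall>\<^sub>F n in F. ?B n \<le> ?A n"
      by (intro always_eventually allI upper)
  qed
qed

section \<open>Separating the disks\<close>

text \<open>
  Only finitely many of the given disks lie inside a given one, because their centres approach the
  unit circle. A disk \<open>D\<^sub>n\<close> is therefore large enough for a slightly smaller disk inside it that
  misses all strictly smaller \<open>D\<^sub>k\<close> contained in \<open>D\<^sub>n\<close>, together with the disks already chosen for
  those earlier \<open>k\<close> with \<open>D\<^sub>k = D\<^sub>n\<close>. Every pair is then separated, since two disks are either nested or
  disjoint. Missing \<open>0\<close> as well keeps the new centres close to the unit circle when
  \<open>D\<^sub>n\<close> is a disk about \<open>0\<close>.
\<close>

lemma ex_disjoint_subdisks:
  fixes z :: "nat \<Rightarrow> 'a::complete_nonarch_field" and r s :: "nat \<Rightarrow> real"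
  assumes z: "\<And>n. z n \<in> open_unit_disk" "(\<lambda>n. absval (z n)) \<longlonglongrightarrow> 1"
    and r: "\<And>n. r n \<in> {0<..<1}" and s: "\<And>n. s n < r n"
  shows "\<exists>w. (\<forall>n. w n \<in> cball (z n) (r n)) \<and> (\<forall>n. s n < absval (w n)) \<and>
    disjoint_family (\<lambda>n. cball (w n) (s n))"
proof -
  \<comment> \<open>the disks inside \<open>D\<^sub>n\<close> that \<open>w\<^sub>n\<close> has to take care of; equal disks are ordered by index\<close>
  define K where "K n = {k. z k \<in> cball (z n) (r n) \<and> (r k < r n \<or> r k = r n \<and> k < n)}" for n
  have fin: "finite (K n)" for n
  proof -
    let ?R = "max (absval (z n)) (r n)"
    have "?R < 1" using z(1)[of n] r[of n] by (simp add: open_unit_disk_def)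
    then have "eventually (\<lambda>k. ?R < absval (z k)) sequentially"
      by (rule order_tendstoD(1)[OF z(2)])
    then have "finite {k. \<not> ?R < absval (z k)}"
      by (simp add: cofinite_eq_sequentially[symmetric] eventually_cofinite)
    moreover have "\<not> ?R < absval (z k)" if "k \<in> K n" for k
      using that dist_ultrametric[of "z k" 0 "z n"]
      by (auto simp: K_def absval_dist_0 dist_commute)
    then have "K n \<subseteq> {k. \<not> ?R < absval (z k)}" by blast
    ultimately show ?thesis by (rule rev_finite_subset)
  qed
  \<comment> \<open>\<open>c\<close> and \<open>t\<close> are the centre and radius of the disk to be missed: \<open>D\<^sub>k\<close> itself if it is
    strictly smaller than \<open>D\<^sub>n\<close>, and the new disk inside \<open>D\<^sub>k\<close> if \<open>D\<^sub>k = D\<^sub>n\<close>. Only the latter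
    choice looks at \<open>w\<close>, and only at smaller indices, so that \<open>w\<close> can be built by recursion.\<close>
  define c where "c w n k = (if r k < r n then z k else w k)" for w :: "nat \<Rightarrow> 'a" and n k
  define t where "t n k = (if r k < r n then r k else s k)" for n k
  define P where "P w n x \<longleftrightarrow> x \<in> cball (z n) (r n) \<and> s n < absval x \<and>
    (\<forall>k\<in>K n. max (s n) (t n k) < dist x (c w n k))" for w n x
  have "\<exists>w. \<forall>n. P w n (w n)"
  proof (rule dependent_wellorder_choice)
    fix n :: nat and x and f g :: "nat \<Rightarrow> 'a"
    assume "\<And>k. k < n \<Longrightarrow> f k = g k"
    then have "c f n k = c g n k" if "k \<in> K n" for k
      using that by (auto simp: c_def K_def)
    then show "P f n x = P g n x" by (simp add: P_def)
  next
    fix n :: nat and f :: "nat \<Rightarrow> 'a"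
    define T where "T = Max (insert (s n) (t n ` K n))"
    have "t n k < r n" if "k \<in> K n" for k
      using that s[of k] by (auto simp: t_def K_def)
    then have T: "T < r n" "s n \<le> T" "\<And>k. k \<in> K n \<Longrightarrow> t n k \<le> T"
      using fin[of n] s[of n] by (auto simp: T_def)
    obtain x where x: "x \<in> cball (z n) (r n)" "\<forall>y\<in>insert 0 (c f n ` K n). T < dist x y"
      using ex_far_point_in_cball[OF T(1), of "insert 0 (c f n ` K n)" "z n"] r[of n] fin[of n] by auto
    then have "P f n x"
      using T unfolding P_def absval_dist_0 by force
    then show "\<exists>x. P f n x" by blast
  qed
  then obtain w where w: "\<And>n. P w n (w n)" by blast
  have w_in: "w n \<in> cball (z n) (r n)" for n
    using w[of n] by (simp add: P_def)
  have sub: "cball (w n) (s n) \<subseteq> cball (z n) (r n)" for n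
    using cball_eq_of_mem[OF w_in[of n]] subset_cball[of "s n" "r n" "w n"] s[of n] by simp
  have disj: "cball (w n) (s n) \<inter> cball (w k) (s k) = {}" if order: "r k < r n \<or> r k = r n \<and> k < n" for n k
  proof (cases "z k \<in> cball (z n) (r n)")
    case True
    with order have "k \<in> K n" by (simp add: K_def)
    then have "max (s n) (t n k) < dist (w n) (c w n k)"
      using w[of n] by (simp add: P_def)
    then have "cball (w n) (s n) \<inter> cball (c w n k) (t n k) = {}"
      by (rule cball_disjoint_of_dist)
    then show ?thesis
      using sub[of k] by (cases "r k < r n") (auto simp: c_def t_def)
  next
    case False
    \<comment> \<open>\<open>r k \<le> r n\<close>, so \<open>D\<^sub>n\<close> and \<open>D\<^sub>k\<close> are disjoint\<close>
    then have "max (r n) (r k) < dist (z n) (z k)"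
      using order by auto
    then have "cball (z n) (r n) \<inter> cball (z k) (r k) = {}"
      by (rule cball_disjoint_of_dist)
    then show ?thesis using sub[of n] sub[of k] by blast
  qed
  have "disjoint_family (\<lambda>n. cball (w n) (s n))"
    unfolding disjoint_family_on_def
  proof (intro ballI impI)
    fix n k :: nat assume "n \<noteq> k"
    then consider "r k < r n \<or> r k = r n \<and> k < n" | "r n < r k \<or> r n = r k \<and> n < k"
      by linarith
    then show "cball (w n) (s n) \<inter> cball (w k) (s k) = {}"
      by cases (use disj[of k n] disj[of n k] in auto)
  qed
  then show ?thesis using w by (auto simp: P_def)
qed

section \<open>Limits along nonprincipal ultrafilters\<close>

text \<open>
  An ultrafilter to which the complement of \<open>{n}\<close> does not belong contains \<open>{n}\<close> and is thus
  principal. So a nonprincipal one contains the complements of all points, hence those of all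
  finite sets.
\<close>

lemma nonprincipal_ultrafilter_le_cofinite:
  fixes F :: "'b filter"
  assumes "nonprincipal_ultrafilter F"
  shows "F \<le> cofinite"
proof -
  have F: "F \<noteq> bot" "\<And>P. eventually P F \<or> eventually (\<lambda>x. \<not> P x) F" "\<And>n. F \<noteq> principal {n}"
    using assms by (auto simp: nonprincipal_ultrafilter_def ultrafilter_def)
  have ne: "eventually (\<lambda>x. x \<noteq> n) F" for n
  proof (rule ccontr)
    assume "\<not> ?thesis"
    then have eq: "eventually (\<lambda>x. x = n) F"
      using F(2)[of "\<lambda>x. x \<noteq> n"] by simp
    have "eventually P F \<longleftrightarrow> P n" for P
    proof
      assume "eventually P F"
      with eq have "eventually (\<lambda>_. P n) F" by eventually_elim simp
      then show "P n" using F(1) by (simp add: eventually_const_iff)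
    next
      assume "P n"
      then show "eventually P F" using eq by (auto elim: eventually_mono)
    qed
    then have "F = principal {n}" by (simp add: filter_eq_iff eventually_principal)
    then show False using F(3) by blast
  qed
  show ?thesis
  proof (rule filter_leI)
    fix P :: "'b \<Rightarrow> bool" assume "eventually P cofinite"
    then have "finite {x. \<not> P x}" by (simp add: eventually_cofinite)
    then have "eventually (\<lambda>x. \<forall>y\<in>{x. \<not> P x}. x \<noteq> y) F"
      by (rule eventually_ball_finite) (simp add: ne)
    then show "eventually P F" by (auto elim: eventually_mono)
  qed
qed

theorem corollary6p3:
  fixes \<UU> :: "nat filter"
    and z :: "nat \<Rightarrow> 'a::complete_nonarch_field"
    and r :: "nat \<Rightarrow> real"
    and \<phi> :: "'a fps \<Rightarrow> real"
  assumes "nonprincipal_ultrafilter \<UU>"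
    and "\<And>n. z n \<in> open_unit_disk"
    and "(\<lambda>n. absval (z n)) \<longlonglongrightarrow> 1"
    and "\<And>n. r n \<in> {0<..<1}"
    and "\<forall>f\<in>Hinf. ((\<lambda>n. disk_seminorm (cball (z n) (r n)) f) \<longlongrightarrow> \<phi> f) \<UU>"
  shows "\<exists>(w :: nat \<Rightarrow> 'a) (s :: nat \<Rightarrow> real).
           (\<forall>n. w n \<in> open_unit_disk) \<and>
           (\<lambda>n. absval (w n)) \<longlonglongrightarrow> 1 \<and>
           (\<forall>n. s n \<in> {0<..<1}) \<and>
           disjoint_family (\<lambda>n. cball (w n) (s n)) \<and>
           (\<forall>f\<in>Hinf. ((\<lambda>n. disk_seminorm (cball (w n) (s n)) f) \<longlongrightarrow> \<phi> f) \<UU>)"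
proof -
  \<comment> \<open>Any null sequence of exponents would preserve the limit; being at most \<open>1\<close> it also gives
    \<open>s\<^sub>n \<ge> r\<^sub>n\<^sup>2\<close>, which keeps \<open>\<bar>w\<^sub>n\<bar>\<close> close to \<open>1\<close> when \<open>\<bar>z\<^sub>n\<bar> \<le> r\<^sub>n\<close>.\<close>
  define \<delta> :: "nat \<Rightarrow> real" where "\<delta> n = 1 / real (Suc n)" for n
  define s where "s n = r n powr (1 + \<delta> n)" for n
  have \<delta>: "0 < \<delta> n" "\<delta> n \<le> 1" for n
    by (auto simp: \<delta>_def)
  have "\<delta> \<longlonglongrightarrow> 0"
    unfolding \<delta>_def using LIMSEQ_inverse_real_of_nat by (simp add: inverse_eq_divide)
  then have \<delta>_lim: "(\<delta> \<longlongrightarrow> 0) \<UU>"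
    using nonprincipal_ultrafilter_le_cofinite[OF assms(1)]
    by (simp add: cofinite_eq_sequentially tendsto_mono)
  have s: "0 < s n" "s n < r n" "(r n)\<^sup>2 \<le> s n" for n
  proof -
    have r: "0 < r n" "r n < 1" using assms(4)[of n] by auto
    show "0 < s n" using r by (simp add: s_def)
    show "s n < r n" using r \<delta>[of n] powr_less_mono'[of "r n" 1 "1 + \<delta> n"] by (simp add: s_def)
    show "(r n)\<^sup>2 \<le> s n"
      using r \<delta>[of n] powr_mono'[of "1 + \<delta> n" 2 "r n"] by (simp add: s_def)
  qed
  obtain w where w: "\<And>n. w n \<in> cball (z n) (r n)" "\<And>n. s n < absval (w n)"
      "disjoint_family (\<lambda>n. cball (w n) (s n))"
    using ex_disjoint_subdisks[of z r s] assms(2-4) s(2) by blast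
  have w_disk: "w n \<in> open_unit_disk" for n
    using w(1)[of n] cball_subset_open_unit_disk[OF assms(2), of "r n" n] assms(4)[of n] by auto
  have w_ge: "(absval (z n))\<^sup>2 \<le> absval (w n)" for n
  proof (cases "r n < absval (z n)")
    case True
    then have "absval (w n) = absval (z n)"
      using w(1)[of n] by (intro absval_eq_of_dist_less) (simp add: dist_commute)
    then show ?thesis
      using assms(2)[of n] absval_nonneg[of "z n"]
      by (simp add: open_unit_disk_def power2_eq_square mult_left_le)
  next
    case False
    then have "(absval (z n))\<^sup>2 \<le> (r n)\<^sup>2"
      by (intro power_mono) (auto simp: absval_nonneg)
    then show ?thesis using s(3)[of n] w(2)[of n] by linarith
  qed
  have "(\<lambda>n. absval (w n)) \<longlonglongrightarrow> 1"
  proof (rule tendsto_sandwich)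
    show "(\<lambda>n. (absval (z n))\<^sup>2) \<longlonglongrightarrow> 1"
      using tendsto_power[OF assms(3), of 2] by simp
    show "\<forall>\<^sub>F n in sequentially. (absval (z n))\<^sup>2 \<le> absval (w n)"
      using w_ge by simp
    show "\<forall>\<^sub>F n in sequentially. absval (w n) \<le> 1"
      using w_disk by (auto simp: open_unit_disk_def intro: always_eventually less_imp_le)
  qed simp
  moreover have "\<forall>n. s n \<in> {0<..<1}"
  proof
    fix n show "s n \<in> {0<..<1}" using s(1,2)[of n] assms(4)[of n] by simp
  qed
  moreover have "\<forall>f\<in>Hinf. ((\<lambda>n. disk_seminorm (cball (w n) (s n)) f) \<longlongrightarrow> \<phi> f) \<UU>"
    unfolding s_def
  proof
    fix f :: "'a fps" assume "f \<in> Hinf"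
    then show "((\<lambda>n. disk_seminorm (cball (w n) (r n powr (1 + \<delta> n))) f) \<longlongrightarrow> \<phi> f) \<UU>"
      using assms(2,4,5) w(1) \<delta>(1) \<delta>_lim by (intro tendsto_disk_seminorm_shrunk) (auto intro: less_imp_le)
  qed
  ultimately show ?thesis using w_disk w(3) by blast
qed

end
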